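(* Let $A$, $B$ and $Y$ be $k$-spaces, with $B$ weak Hausdorff. If $q:Y\to B$ is an identification and $f:A\to B$ is a continuous map, then the projection $f^{\ast}q:Y\sqcap A\to A$ is an identification.
   Context: For a topological space $X$, $kX$ is the set $X$ with the final topology relative to all continuous maps $C\to X$ from compact Hausdorff spaces $C$; $X$ is a $k$-space if $kX=X$. All constructions are $k$-ified: $X\times Y$ means $k$ of the usual product, and the pullback $Y\sqcap A=\{(y,a): q(y)=f(a)\}$ has the $k$-ification of the subspace topology from the usual product; $f^{\ast}q(y,a)=a$. $B$ is weak Hausdorff if its diagonal is closed in the ($k$-ified) product $B\times B$. An identification is a surjective quotient map (the target has the final topology relative to the map). *)

theory Defs
  imports "HOL-Analysis.Analysis"
begin

text \<open>
  The \<open>k\<close>-ification is the final topology for the continuous maps into \<open>X\<close> from all compact Hausdorff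
  spaces. HOL cannot quantify over types inside a definition, so the test spaces \<open>C\<close> are taken
  on a fixed type that is large enough relative to the points of \<open>X\<close>. This is no restriction:
  by \<open>openin_ch_kification_preimage\<close> below, the sets that are open in \<open>ch_kification X\<close> have open preimages
  under the continuous maps into \<open>X\<close> from the compact Hausdorff spaces on \<^emph>\<open>every\<close> type.

  The library's \<open>kification\<close> and \<open>k_space\<close> are different notions: they test against the compact
  subspaces of \<open>X\<close>, Hausdorff or not, so that every compact space is a \<open>k_space\<close>.
\<close>

definition ch_kification :: "'a topology \<Rightarrow> 'a topology" where
  "ch_kification X = topology (\<lambda>U. U \<subseteq> topspace X \<and>
     (\<forall>(C :: 'a set list set topology) g.
        compact_space C \<and> Hausdorff_space C \<and> continuous_map C X g \<longrightarrow>
        openin C {c \<in> topspace C. g c \<in> U}))"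

definition ch_k_space :: "'a topology \<Rightarrow> bool" where
  "ch_k_space X \<longleftrightarrow> ch_kification X = X"

definition ch_k_prod :: "'a topology \<Rightarrow> 'b topology \<Rightarrow> ('a \<times> 'b) topology" where
  "ch_k_prod X Y = ch_kification (prod_topology X Y)"

definition weak_Hausdorff_space :: "'a topology \<Rightarrow> bool" where
  "weak_Hausdorff_space B \<longleftrightarrow> closedin (ch_k_prod B B) ((\<lambda>b. (b, b)) ` topspace B)"

definition ch_k_pullback ::
  "'y topology \<Rightarrow> 'a topology \<Rightarrow> ('y \<Rightarrow> 'b) \<Rightarrow> ('a \<Rightarrow> 'b) \<Rightarrow> ('y \<times> 'a) topology" where
  "ch_k_pullback Y A q f = ch_kification (subtopology (prod_topology Y A)
     {(y, a). y \<in> topspace Y \<and> a \<in> topspace A \<and> q y = f a})"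

lemma openin_ch_kification:
  fixes X :: "'a topology"
  shows "openin (ch_kification X) U \<longleftrightarrow> U \<subseteq> topspace X \<and>
     (\<forall>(C :: 'a set list set topology) g.
        compact_space C \<and> Hausdorff_space C \<and> continuous_map C X g \<longrightarrow>
        openin C {c \<in> topspace C. g c \<in> U})"
proof -
  let ?P = "\<lambda>U. U \<subseteq> topspace X \<and>
     (\<forall>(C :: 'a set list set topology) g.
        compact_space C \<and> Hausdorff_space C \<and> continuous_map C X g \<longrightarrow>
        openin C {c \<in> topspace C. g c \<in> U})"
  have "istopology ?P"
    unfolding istopology_def
  proof (intro conjI allI impI)
    fix S T assume S: "?P S" and T: "?P T"
    then show "S \<inter> T \<subseteq> topspace X" by blast
    fix C :: "'a set list set topology" and g
    assume C: "compact_space C \<and> Hausdorff_space C \<and> continuous_map C X g"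
    have "{c \<in> topspace C. g c \<in> S \<inter> T} = {c \<in> topspace C. g c \<in> S} \<inter> {c \<in> topspace C. g c \<in> T}"
      by blast
    then show "openin C {c \<in> topspace C. g c \<in> S \<inter> T}"
      using S T C by (metis (no_types, lifting) openin_Int)
  next
    fix K assume K: "\<forall>S\<in>K. ?P S"
    then show "\<Union> K \<subseteq> topspace X" by blast
    fix C :: "'a set list set topology" and g
    assume C: "compact_space C \<and> Hausdorff_space C \<and> continuous_map C X g"
    have eq: "{c \<in> topspace C. g c \<in> \<Union> K} = \<Union> ((\<lambda>S. {c \<in> topspace C. g c \<in> S}) ` K)"
      by blast
    show "openin C {c \<in> topspace C. g c \<in> \<Union> K}"
      unfolding eq using K C by (intro openin_Union) blast
  qed
  then show ?thesis
    by (simp add: ch_kification_def)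
qed

lemma topspace_ch_kification [simp]: "topspace (ch_kification X) = topspace X"
proof -
  have "openin (ch_kification X) (topspace X)"
    by (auto simp: openin_ch_kification continuous_map_def Pi_iff
        intro: openin_subopen[THEN iffD2])
  then show ?thesis
    by (metis openin_ch_kification openin_subset openin_topspace subset_antisym)
qed

lemma openin_imp_openin_ch_kification: "openin X U \<Longrightarrow> openin (ch_kification X) U"
  unfolding openin_ch_kification by (auto simp: openin_subset intro: openin_continuous_map_preimage)

text \<open>
  A family of closed sets of a compact space that is a normal lattice has a compact Hausdorff
  Wallman space; its points are the maximal sets of the form \<open>{i. c \<in> L i}\<close>.
\<close>

lemma wallman_space:
  fixes C :: "'c topology" and L :: "'i \<Rightarrow> 'c set"
  assumes C: "compact_space C"
    and closed: "\<And>i. closedin C (L i)"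
    and bot: "\<exists>i. L i = {}"
    and cap: "\<And>i j. \<exists>k. L k = L i \<inter> L j"
    and cup: "\<And>i j. \<exists>k. L k = L i \<union> L j"
    and norm: "\<And>i j. L i \<inter> L j = {} \<Longrightarrow>
      \<exists>k l. L k \<union> L l = topspace C \<and> L i \<inter> L l = {} \<and> L j \<inter> L k = {}"
  obtains W :: "'i set topology" where "compact_space W" "Hausdorff_space W"
    "\<And>t. t \<in> topspace W \<Longrightarrow> \<exists>c \<in> topspace C. t = {i. c \<in> L i}"
    "\<And>c i. L i = {c} \<Longrightarrow> {i. c \<in> L i} \<in> topspace W"
    "\<And>U. openin W U \<longleftrightarrow> U \<subseteq> topspace W \<and> (\<forall>t\<in>U. \<exists>i. i \<notin> t \<and> {s \<in> topspace W. i \<notin> s} \<subseteq> U)"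
proof -
  define tr where "tr c = {i. c \<in> L i}" for c
  define T where "T = {t \<in> tr ` topspace C. \<forall>c \<in> topspace C. t \<subseteq> tr c \<longrightarrow> tr c = t}"
  have fip: "\<exists>d\<in>topspace C. J \<subseteq> tr d"
    if J: "\<And>I. finite I \<Longrightarrow> I \<subseteq> J \<Longrightarrow> \<exists>d\<in>topspace C. I \<subseteq> tr d" for J
  proof -
    have "\<Inter> (insert (topspace C) (L ` J)) \<noteq> {}"
    proof (rule C[unfolded compact_space_fip, rule_format], intro conjI ballI allI impI)
      fix K assume "K \<in> insert (topspace C) (L ` J)"
      then show "closedin C K" using closed by auto
    next
      fix F assume F: "finite F \<and> F \<subseteq> insert (topspace C) (L ` J)"
      then have "finite (F - {topspace C})" "F - {topspace C} \<subseteq> L ` J" by auto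
      then obtain I where I: "finite I" "I \<subseteq> J" "F - {topspace C} = L ` I"
        by (meson finite_subset_image)
      obtain d where d: "d \<in> topspace C" "I \<subseteq> tr d" using J[OF I(1,2)] by blast
      have "d \<in> K" if "K \<in> F" for K
      proof (cases "K = topspace C")
        case False
        then have "K \<in> L ` I" using that I(3) by blast
        then show ?thesis using d(2) unfolding tr_def by auto
      qed (use d in simp)
      then show "\<Inter> F \<noteq> {}" by auto
    qed
    then show ?thesis by (auto simp: tr_def)
  qed
  have ext: "\<exists>t\<in>T. tr c \<subseteq> t" if c: "c \<in> topspace C" for c
  proof -
    let ?A = "{tr d |d. d \<in> topspace C \<and> tr c \<subseteq> tr d}"
    have "\<exists>M\<in>?A. \<forall>X\<in>?A. M \<subseteq> X \<longrightarrow> X = M"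
    proof (rule subset_Zorn)
      fix K assume K: "subset.chain ?A K"
      then have KA: "K \<subseteq> ?A" by (simp add: subset_chain_def)
      show "\<exists>U\<in>?A. \<forall>X\<in>K. X \<subseteq> U"
      proof (cases "K = {}")
        case True
        then show ?thesis using c by blast
      next
        case False
        have "\<exists>d\<in>topspace C. \<Union>K \<subseteq> tr d"
        proof (rule fip)
          fix I assume "finite I" "I \<subseteq> \<Union>K"
          then obtain X where "X \<in> K" "I \<subseteq> X"
            using finite_subset_Union_chain[OF _ _ False K] by blast
          moreover from \<open>X \<in> K\<close> KA obtain d where "X = tr d" "d \<in> topspace C" by auto
          ultimately show "\<exists>d\<in>topspace C. I \<subseteq> tr d" by auto
        qed
        then obtain d where d: "d \<in> topspace C" "\<Union>K \<subseteq> tr d" by (elim bexE)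
        have "tr c \<subseteq> tr d"
        proof -
          obtain X where "X \<in> K" using False by auto
          then have "tr c \<subseteq> X" "X \<subseteq> tr d" using KA d(2) by auto
          then show ?thesis by simp
        qed
        then have "tr d \<in> ?A" using d(1) by auto
        moreover have "\<forall>X\<in>K. X \<subseteq> tr d" using d(2) by (simp add: Sup_le_iff)
        ultimately show ?thesis by (rule bexI[rotated])
      qed
    qed
    then obtain M where M: "M \<in> ?A" "\<forall>X\<in>?A. M \<subseteq> X \<longrightarrow> X = M" by (elim bexE)
    then obtain d where d: "M = tr d" "d \<in> topspace C" "tr c \<subseteq> tr d" by auto
    have "tr e = tr d" if e: "e \<in> topspace C" "tr d \<subseteq> tr e" for e
    proof -
      have "tr e \<in> ?A" using e d by auto
      then show ?thesis using M(2) e(2) d(1) by simp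
    qed
    then have "tr d \<in> T" unfolding T_def using d(2) by simp
    with d(3) show ?thesis by (rule bexI)
  qed
  let ?op = "\<lambda>U. U \<subseteq> T \<and> (\<forall>t\<in>U. \<exists>i. i \<notin> t \<and> {s \<in> T. i \<notin> s} \<subseteq> U)"
  have T_tr: "\<exists>c\<in>topspace C. t = tr c" if "t \<in> T" for t
    using that unfolding T_def by blast
  have "istopology ?op"
    unfolding istopology_def
  proof (intro conjI allI impI ballI)
    fix S S' assume S: "?op S" and S': "?op S'"
    then show "S \<inter> S' \<subseteq> T" by blast
    fix t assume t: "t \<in> S \<inter> S'"
    obtain i where i: "i \<notin> t" "{s \<in> T. i \<notin> s} \<subseteq> S"
      using S[THEN conjunct2, rule_format, of t] t by auto
    obtain j where j: "j \<notin> t" "{s \<in> T. j \<notin> s} \<subseteq> S'"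
      using S'[THEN conjunct2, rule_format, of t] t by auto
    obtain k where k: "L k = L i \<union> L j" using cup by blast
    have "k \<in> s \<longleftrightarrow> i \<in> s \<or> j \<in> s" if "s \<in> T" for s
      using T_tr[OF that] k unfolding tr_def by auto
    moreover have "t \<in> T" using t S by auto
    ultimately show "\<exists>i. i \<notin> t \<and> {s \<in> T. i \<notin> s} \<subseteq> S \<inter> S'"
      using i j by (intro exI[of _ k]) auto
  next
    fix K assume K: "\<forall>S\<in>K. ?op S"
    then show "\<Union> K \<subseteq> T" by blast
    fix t assume "t \<in> \<Union> K"
    then obtain S where "S \<in> K" "t \<in> S" by blast
    then obtain i where "i \<notin> t" "{s \<in> T. i \<notin> s} \<subseteq> S"
      using K[rule_format, THEN conjunct2, rule_format, of S t] by auto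
    then show "\<exists>i. i \<notin> t \<and> {s \<in> T. i \<notin> s} \<subseteq> \<Union> K"
      using \<open>S \<in> K\<close> by (intro exI[of _ i]) auto
  qed
  define W where "W = topology ?op"
  have op: "openin W U \<longleftrightarrow> ?op U" for U
    unfolding W_def using \<open>istopology ?op\<close> by simp
  obtain i0 where "L i0 = {}" using bot by blast
  then have "i0 \<notin> t" if "t \<in> T" for t using T_tr[OF that] unfolding tr_def by auto
  then have "?op T" by auto
  then have top: "topspace W = T"
    by (metis op openin_subset openin_topspace subset_antisym)
  have basic: "openin W {s \<in> T. i \<notin> s}" for i
    unfolding op by auto
  have "compact_space W"
    unfolding compact_space top
  proof (intro allI impI)
    fix \<U> assume U: "(\<forall>U\<in>\<U>. openin W U) \<and> \<Union> \<U> = T"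
    define J where "J = {i. \<exists>U\<in>\<U>. {s \<in> T. i \<notin> s} \<subseteq> U}"
    have "\<not> (\<exists>d\<in>topspace C. J \<subseteq> tr d)"
    proof
      assume "\<exists>d\<in>topspace C. J \<subseteq> tr d"
      then obtain d where d: "d \<in> topspace C" "J \<subseteq> tr d" by (elim bexE)
      obtain t where t: "t \<in> T" "tr d \<subseteq> t" using ext[OF d(1)] by (elim bexE)
      obtain V where V: "V \<in> \<U>" "t \<in> V" using U t(1) by auto
      then have "?op V" using U op by simp
      then obtain i where i: "i \<notin> t" "{s \<in> T. i \<notin> s} \<subseteq> V" using V(2) by auto
      then have "i \<in> J" unfolding J_def using V(1) by auto
      then show False using d(2) t(2) i(1) by auto
    qed
    then obtain I where I: "finite I" "I \<subseteq> J" "\<not> (\<exists>d\<in>topspace C. I \<subseteq> tr d)"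
      using fip[of J] by metis
    from I(2) have "\<forall>i\<in>I. \<exists>U. U \<in> \<U> \<and> {s \<in> T. i \<notin> s} \<subseteq> U" unfolding J_def by auto
    then obtain h where h: "\<forall>i\<in>I. h i \<in> \<U> \<and> {s \<in> T. i \<notin> s} \<subseteq> h i" by metis
    have "\<Union> (h ` I) = T"
    proof
      show "\<Union> (h ` I) \<subseteq> T" using h U by (metis UN_least Union_upper)
      show "T \<subseteq> \<Union> (h ` I)"
      proof
        fix t assume t: "t \<in> T"
        then obtain c where "c \<in> topspace C" "t = tr c" using T_tr by auto
        then obtain i where i: "i \<in> I" "i \<notin> t" using I(3) by auto
        then have "t \<in> h i" using h t by auto
        then show "t \<in> \<Union> (h ` I)" using i(1) by auto
      qed
    qed
    then show "\<exists>\<F>. finite \<F> \<and> \<F> \<subseteq> \<U> \<and> \<Union> \<F> = T"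
      using I(1) h by (intro exI[of _ "h ` I"]) auto
  qed
  moreover have "Hausdorff_space W"
    unfolding Hausdorff_space_def top
  proof (intro allI impI)
    fix t u assume tu: "t \<in> T \<and> u \<in> T \<and> t \<noteq> u"
    then obtain c d where c: "c \<in> topspace C" "t = tr c" and d: "d \<in> topspace C" "u = tr d"
      using T_tr by metis
    have "\<not> t \<subseteq> u" using tu d unfolding T_def by auto
    then obtain i where i: "i \<in> t" "i \<notin> u" by blast
    have "\<exists>j\<in>u. L i \<inter> L j = {}"
    proof (rule ccontr)
      assume meet: "\<not> ?thesis"
      have inter: "\<exists>k\<in>u. L k \<subseteq> \<Inter> (L ` I)" if "finite I" "I \<noteq> {}" "I \<subseteq> u" for I
        using that
      proof (induction I rule: finite_ne_induct)
        case (singleton x)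
        then show ?case by auto
      next
        case (insert x F)
        then obtain k where k: "k \<in> u" "L k \<subseteq> \<Inter> (L ` F)" by auto
        obtain l where l: "L l = L x \<inter> L k" using cap by blast
        then have "l \<in> u" using insert.prems k(1) d(2) unfolding tr_def by auto
        then show ?case using l k by auto
      qed
      have "\<exists>e\<in>topspace C. insert i u \<subseteq> tr e"
      proof (rule fip)
        fix I assume I: "finite I" "I \<subseteq> insert i u"
        show "\<exists>e\<in>topspace C. I \<subseteq> tr e"
        proof (cases "I - {i} = {}")
          case True
          then have "I \<subseteq> tr c" using i(1) c(2) by auto
          then show ?thesis using c(1) by (rule bexI)
        next
          case False
          moreover have "finite (I - {i})" "I - {i} \<subseteq> u" using I by auto
          ultimately obtain k where k: "k \<in> u" "L k \<subseteq> \<Inter> (L ` (I - {i}))" using inter by metis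
          have "L i \<inter> L k \<noteq> {}" using meet k(1) by simp
          then obtain e where e: "e \<in> L i" "e \<in> L k" by auto
          then have "e \<in> topspace C" using closed closedin_subset by (metis subsetD)
          moreover have "I \<subseteq> tr e" using e k(2) unfolding tr_def by auto
          ultimately show ?thesis by (rule bexI[rotated])
        qed
      qed
      then obtain e where e: "e \<in> topspace C" "insert i u \<subseteq> tr e" by (elim bexE)
      then have "tr e = u" using tu unfolding T_def by simp
      then show False using e(2) i(2) by simp
    qed
    then obtain j where j: "j \<in> u" "L i \<inter> L j = {}" by (elim bexE)
    then obtain k l where kl: "L k \<union> L l = topspace C" "L i \<inter> L l = {}" "L j \<inter> L k = {}"
      using norm by metis
    have "t \<in> {s \<in> T. l \<notin> s}" "u \<in> {s \<in> T. k \<notin> s}"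
      using tu kl i j c d unfolding tr_def by auto
    moreover have "l \<in> s \<or> k \<in> s" if "s \<in> T" for s
      using kl(1) T_tr[OF that] unfolding tr_def by auto
    then have "disjnt {s \<in> T. l \<notin> s} {s \<in> T. k \<notin> s}"
      unfolding disjnt_def by auto
    ultimately show "\<exists>U V. openin W U \<and> openin W V \<and> t \<in> U \<and> u \<in> V \<and> disjnt U V"
      using basic by metis
  qed
  moreover have "\<exists>c \<in> topspace C. t = {i. c \<in> L i}" if "t \<in> topspace W" for t
    using T_tr that unfolding top tr_def .
  moreover have "{i. c \<in> L i} \<in> topspace W" if i: "L i = {c}" for c i
  proof -
    have "c \<in> topspace C" using closed[of i] i closedin_subset by fastforce
    moreover have "d = c" if "tr c \<subseteq> tr d" for d using that i unfolding tr_def by auto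
    ultimately have "tr c \<in> T" unfolding T_def by auto
    then show ?thesis unfolding top tr_def .
  qed
  moreover have "openin W U \<longleftrightarrow>
      U \<subseteq> topspace W \<and> (\<forall>t\<in>U. \<exists>i. i \<notin> t \<and> {s \<in> topspace W. i \<notin> s} \<subseteq> U)" for U
    unfolding top by (rule op)
  ultimately show thesis
    by (rule that)
qed

text \<open>
  Names for the members of a normal lattice of closed sets of \<open>C\<close> that contains the preimages of the
  closed sets of \<open>X\<close>: \<open>Sepl\<close> and \<open>Sepr\<close> separate disjoint closed sets, \<open>Point\<close> is a point \<open>p\<close> in the
  closure of a set \<open>D\<close>, and \<open>Avoid\<close> picks a point of \<open>D\<close> outside a closed set that misses \<open>p\<close>.
\<close>

datatype 'x lterm = Closed 'x | Point | Cap "'x lterm" "'x lterm" | Cup "'x lterm" "'x lterm"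
  | Sepl "'x lterm" "'x lterm" | Sepr "'x lterm" "'x lterm" | Avoid "'x lterm"

primrec lcode :: "'a set lterm \<Rightarrow> 'a set list" where
  "lcode (Closed F) = [UNIV, F]"
| "lcode Point = [{}, UNIV]"
| "lcode (Cap s t) = [{}, {}, UNIV] @ lcode s @ lcode t"
| "lcode (Cup s t) = [{}, {}, {}, UNIV] @ lcode s @ lcode t"
| "lcode (Sepl s t) = [{}, {}, {}, {}, UNIV] @ lcode s @ lcode t"
| "lcode (Sepr s t) = [{}, {}, {}, {}, {}, UNIV] @ lcode s @ lcode t"
| "lcode (Avoid s) = [{}, {}, {}, {}, {}, {}, UNIV] @ lcode s"

lemma lcode_append_eq: "lcode s @ xs = lcode t @ ys \<Longrightarrow> s = t \<and> xs = ys"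
proof (induction s arbitrary: t xs ys)
  case (Closed F) then show ?case by (cases t) auto
next
  case Point then show ?case by (cases t) auto
next
  case (Cap s1 s2) from Cap.prems show ?case by (cases t) (auto dest!: Cap.IH)
next
  case (Cup s1 s2) from Cup.prems show ?case by (cases t) (auto dest!: Cup.IH)
next
  case (Sepl s1 s2) from Sepl.prems show ?case by (cases t) (auto dest!: Sepl.IH)
next
  case (Sepr s1 s2) from Sepr.prems show ?case by (cases t) (auto dest!: Sepr.IH)
next
  case (Avoid s) from Avoid.prems show ?case by (cases t) (auto dest!: Avoid.IH)
qed

lemma inj_lcode: "inj lcode"
  using lcode_append_eq[of _ "[]" _ "[]"] by (intro injI) simp

theorem openin_ch_kification_preimage:
  fixes X :: "'a topology" and C :: "'c topology"
  assumes U: "openin (ch_kification X) U"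
    and C: "compact_space C" "Hausdorff_space C" and g: "continuous_map C X g"
  shows "openin C {c \<in> topspace C. g c \<in> U}"
proof (rule ccontr)
  assume nonopen: "\<not> ?thesis"
  define D where "D = {c \<in> topspace C. g c \<notin> U}"
  obtain p where p: "p \<in> topspace C" "g p \<in> U"
    and cl: "\<And>L. closedin C L \<Longrightarrow> p \<notin> L \<Longrightarrow> \<exists>d\<in>D. d \<notin> L"
  proof -
    obtain p where p: "p \<in> topspace C" "g p \<in> U"
      and no: "\<nexists>V. openin C V \<and> p \<in> V \<and> V \<subseteq> {c \<in> topspace C. g c \<in> U}"
      using nonopen by (subst (asm) openin_subopen) blast
    have "\<exists>d\<in>D. d \<notin> L" if "closedin C L" "p \<notin> L" for L
    proof (rule ccontr)
      assume "\<not> ?thesis"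
      then have "topspace C - L \<subseteq> {c \<in> topspace C. g c \<in> U}" unfolding D_def by blast
      then show False using no that p by blast
    qed
    with p that show thesis by blast
  qed
  have "normal_space C"
    using C compact_Hausdorff_or_regular_imp_normal_space by blast
  have "\<exists>K M. closedin C K \<and> closedin C M \<and>
      (closedin C E \<and> closedin C F \<and> E \<inter> F = {} \<longrightarrow>
        K \<union> M = topspace C \<and> E \<inter> M = {} \<and> F \<inter> K = {})" for E F
  proof (cases "closedin C E \<and> closedin C F \<and> E \<inter> F = {}")
    case True
    then obtain V V' where V: "openin C V" "openin C V'" "E \<subseteq> V" "F \<subseteq> V'" "disjnt V V'"
      using \<open>normal_space C\<close> unfolding normal_space_def disjnt_def by meson
    have "closedin C (topspace C - V')" "closedin C (topspace C - V)" using V by blast+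
    then show ?thesis using V
      by (intro exI[of _ "topspace C - V'"] exI[of _ "topspace C - V"]) (auto simp: disjnt_def)
  next
    case False
    then show ?thesis by blast
  qed
  then obtain sl sr where sep: "\<And>E F. closedin C (sl E F) \<and> closedin C (sr E F) \<and>
      (closedin C E \<and> closedin C F \<and> E \<inter> F = {} \<longrightarrow>
        sl E F \<union> sr E F = topspace C \<and> E \<inter> sr E F = {} \<and> F \<inter> sl E F = {})"
    by metis
  have "\<exists>d\<in>topspace C. closedin C L \<and> p \<notin> L \<longrightarrow> d \<in> D \<and> d \<notin> L" for L
    using cl[of L] p unfolding D_def by blast
  then obtain av where av: "\<And>L. av L \<in> topspace C \<and> (closedin C L \<and> p \<notin> L \<longrightarrow> av L \<in> D \<and> av L \<notin> L)"
    by metis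
  define ev where "ev = rec_lterm
      (\<lambda>F. if closedin X F then {c \<in> topspace C. g c \<in> F} else {})
      {p} (\<lambda>_ _ E F. E \<inter> F) (\<lambda>_ _ E F. E \<union> F) (\<lambda>_ _ E F. sl E F) (\<lambda>_ _ E F. sr E F) (\<lambda>_ E. {av E})"
  have ev: "ev (Closed F) = (if closedin X F then {c \<in> topspace C. g c \<in> F} else {})"
    "ev Point = {p}" "ev (Cap s t) = ev s \<inter> ev t" "ev (Cup s t) = ev s \<union> ev t"
    "ev (Sepl s t) = sl (ev s) (ev t)" "ev (Sepr s t) = sr (ev s) (ev t)" "ev (Avoid s) = {av (ev s)}"
    for F s t by (simp_all add: ev_def)
  have ev_closed: "closedin C (ev s)" for s
  proof (induction s)
    case (Closed F)
    then show ?case using closedin_continuous_map_preimage[OF g] by (simp add: ev)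
  qed (use p av sep C in \<open>auto simp: ev closedin_Hausdorff_singleton\<close>)
  define L where "L = ev \<circ> inv lcode"
  have ex_L: "\<exists>i. L i = ev s" for s
    unfolding L_def comp_def using inv_f_f[OF inj_lcode] by metis
  have L_ev: "\<exists>s. L i = ev s" for i unfolding L_def comp_def by blast
  obtain W :: "'a set list set topology" where W: "compact_space W" "Hausdorff_space W"
    and W_tr: "\<And>t. t \<in> topspace W \<Longrightarrow> \<exists>c \<in> topspace C. t = {i. c \<in> L i}"
    and W_pt: "\<And>c i. L i = {c} \<Longrightarrow> {i. c \<in> L i} \<in> topspace W"
    and W_op: "\<And>U. openin W U \<longleftrightarrow>
        U \<subseteq> topspace W \<and> (\<forall>t\<in>U. \<exists>i. i \<notin> t \<and> {s \<in> topspace W. i \<notin> s} \<subseteq> U)"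
  proof (rule wallman_space[OF C(1), of L])
    show "closedin C (L i)" for i using L_ev[of i] ev_closed by auto
    show "\<exists>i. L i = {}" using ex_L[of "Closed {}"] by (simp add: ev)
    show "\<exists>k. L k = L i \<inter> L j" for i j using ex_L L_ev[of i] L_ev[of j] ev(3) by metis
    show "\<exists>k. L k = L i \<union> L j" for i j using ex_L L_ev[of i] L_ev[of j] ev(4) by metis
    show "\<exists>k l. L k \<union> L l = topspace C \<and> L i \<inter> L l = {} \<and> L j \<inter> L k = {}"
      if disj: "L i \<inter> L j = {}" for i j
    proof -
      obtain s t where st: "L i = ev s" "L j = ev t" using L_ev by metis
      obtain k l where kl: "L k = sl (ev s) (ev t)" "L l = sr (ev s) (ev t)" using ex_L ev(5,6) by metis
      then show ?thesis using sep[of "ev s" "ev t"] ev_closed disj st by metis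
    qed
  qed (rule that)
  define h where "h t = g (SOME c. c \<in> topspace C \<and> t = {i. c \<in> L i})" for t
  have h_ex: "\<exists>c\<in>topspace C. t = {i. c \<in> L i} \<and> h t = g c" if "t \<in> topspace W" for t
    unfolding h_def using W_tr[OF that] someI_ex[of "\<lambda>c. c \<in> topspace C \<and> t = {i. c \<in> L i}"] by blast
  have h_pt: "h {i. c \<in> L i} = g c" if i: "L i = {c}" for c i
  proof -
    obtain c' where c': "{i. c \<in> L i} = {i. c' \<in> L i}" "h {i. c \<in> L i} = g c'"
      using h_ex[OF W_pt[OF i]] by blast
    have "i \<in> {i. c \<in> L i}" using i by blast
    then have "c' = c" unfolding c'(1) using i by blast
    with c' show ?thesis by simp
  qed
  have "continuous_map W X h"
    unfolding continuous_map_closedin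
  proof (intro conjI allI impI ballI funcsetI)
    fix t assume "t \<in> topspace W"
    then show "h t \<in> topspace X" using h_ex g by (metis continuous_map_image_subset_topspace image_subset_iff)
  next
    fix F assume F: "closedin X F"
    obtain i where i: "L i = {c \<in> topspace C. g c \<in> F}" using ex_L[of "Closed F"] F by (auto simp: ev)
    have "h t \<in> F \<longleftrightarrow> i \<in> t" if t: "t \<in> topspace W" for t
    proof -
      obtain c where "c \<in> topspace C" "t = {i. c \<in> L i}" "h t = g c" using h_ex[OF t] by blast
      then show ?thesis using i by simp
    qed
    then have "topspace W - {t \<in> topspace W. h t \<in> F} = {t \<in> topspace W. i \<notin> t}" by blast
    moreover have "openin W {t \<in> topspace W. i \<notin> t}" unfolding W_op by blast
    ultimately show "closedin W {t \<in> topspace W. h t \<in> F}" unfolding closedin_def by auto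
  qed
  then have op: "openin W {t \<in> topspace W. h t \<in> U}"
    using U W unfolding openin_ch_kification by blast
  obtain j where j: "L j = {p}" using ex_L[of Point] by (auto simp: ev)
  have "{i. p \<in> L i} \<in> {t \<in> topspace W. h t \<in> U}"
    using W_pt[OF j] h_pt[OF j] p by simp
  then obtain i where i: "p \<notin> L i" "{s \<in> topspace W. i \<notin> s} \<subseteq> {t \<in> topspace W. h t \<in> U}"
    using op[unfolded W_op, THEN conjunct2, rule_format, of "{i. p \<in> L i}"] by auto
  obtain s where s: "L i = ev s" using L_ev by blast
  define d where "d = av (ev s)"
  have d: "d \<in> D" "d \<notin> L i" unfolding d_def s using av[of "ev s"] ev_closed i(1) s by auto
  obtain k where k: "L k = {d}" using ex_L[of "Avoid s"] by (auto simp: ev d_def)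
  have "{i. d \<in> L i} \<in> {s \<in> topspace W. i \<notin> s}" using W_pt[OF k] d(2) by simp
  then have "h {i. d \<in> L i} \<in> U" using i(2) by blast
  then show False using h_pt[OF k] d(1) unfolding D_def by simp
qed

theorem continuous_map_into_ch_kification:
  fixes X :: "'a topology" and C :: "'c topology"
  assumes "compact_space C" "Hausdorff_space C"
  shows "continuous_map C (ch_kification X) g \<longleftrightarrow> continuous_map C X g"
proof
  assume "continuous_map C X g"
  then show "continuous_map C (ch_kification X) g"
    using openin_ch_kification_preimage[OF _ assms] by (auto simp: continuous_map_def)
next
  assume "continuous_map C (ch_kification X) g"
  then show "continuous_map C X g"
    by (simp add: continuous_map_def openin_imp_openin_ch_kification)
qed

end

theory Submission
  imports Defs
begin

text \<open>
  Testing openness in \<open>A\<close> along maps from compact Hausdorff spaces \<open>C\<close> replaces \<open>f\<close> by a map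
  \<open>h : C \<rightarrow> B\<close>. The ordinary products \<open>B \<times> C\<close> and \<open>Y \<times> C\<close> are \<open>k\<close>-spaces because \<open>C\<close> is
  compact Hausdorff, so weak Hausdorffness of \<open>B\<close> makes the graph of \<open>h\<close> closed in \<open>B \<times> C\<close>.
  By Whitehead's theorem \<open>q \<times> id : Y \<times> C \<rightarrow> B \<times> C\<close> is an identification, and it remains one over
  the closed graph, which projects homeomorphically onto \<open>C\<close>; its preimage is the pullback of \<open>q\<close>
  along \<open>h\<close>. This pullback is closed in \<open>Y \<times> C\<close>, hence already a \<open>k\<close>-space.
\<close>

lemma ch_k_space_iff: "ch_k_space X \<longleftrightarrow> (\<forall>U. openin (ch_kification X) U \<longrightarrow> openin X U)"
  unfolding ch_k_space_def topology_eq using openin_imp_openin_ch_kification by blast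

lemma ch_k_space_openinI:
  fixes X :: "'a topology"
  assumes "ch_k_space X" "U \<subseteq> topspace X"
    and "\<And>(C :: 'a set list set topology) g.
        \<lbrakk>compact_space C; Hausdorff_space C; continuous_map C X g\<rbrakk>
          \<Longrightarrow> openin C {c \<in> topspace C. g c \<in> U}"
  shows "openin X U"
  using assms unfolding ch_k_space_iff by (simp add: openin_ch_kification)

text \<open>Composing a test map into \<open>X\<close> with \<open>f\<close> gives a map from a
  compact Hausdorff space into \<open>Z\<close>. Its domain lives on the test type for
  \<open>X\<close>, not the one for \<open>Z\<close>, hence the appeal to
  \<open>openin_ch_kification_preimage\<close>.\<close>

lemma continuous_map_ch_kification:
  assumes X: "ch_k_space X" and f: "continuous_map X Z f"
  shows "continuous_map X (ch_kification Z) f"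
  unfolding continuous_map_def
proof (intro conjI allI impI)
  show "f \<in> topspace X \<rightarrow> topspace (ch_kification Z)"
    using f by (simp add: continuous_map_def)
next
  fix U assume U: "openin (ch_kification Z) U"
  show "openin X {x \<in> topspace X. f x \<in> U}"
  proof (rule ch_k_space_openinI[OF X])
    fix C :: "'a set list set topology" and g
    assume C: "compact_space C" "Hausdorff_space C" and g: "continuous_map C X g"
    have "openin C {c \<in> topspace C. (f \<circ> g) c \<in> U}"
      by (rule openin_ch_kification_preimage[OF U C continuous_map_compose[OF g f]])
    moreover have "g c \<in> topspace X" if "c \<in> topspace C" for c
      using g that by (auto simp: continuous_map_def)
    ultimately show "openin C {c \<in> topspace C. g c \<in> {x \<in> topspace X. f x \<in> U}}"
      by (simp add: conj_commute cong: conj_cong)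
  qed auto
qed

text \<open>A test map into \<open>X\<close> restricts to the preimage of \<open>S\<close>, which is
  closed and so again compact Hausdorff; the restriction is a test map into
  \<open>S\<close>.\<close>

lemma ch_k_space_closed_subtopology:
  assumes X: "ch_k_space X" and S: "closedin X S"
  shows "ch_k_space (subtopology X S)"
  unfolding ch_k_space_iff
proof (intro allI impI)
  fix U assume U: "openin (ch_kification (subtopology X S)) U"
  have US: "U \<subseteq> S" "S \<subseteq> topspace X"
    using openin_subset[OF U] closedin_subset[OF S] by auto
  \<comment> \<open>Adding the complement of \<open>S\<close> leaves the trace on \<open>S\<close>
    unchanged and makes the set a candidate for being open in \<open>X\<close>.\<close>
  have "openin X (U \<union> (topspace X - S))"
  proof (rule ch_k_space_openinI[OF X])
    show "U \<union> (topspace X - S) \<subseteq> topspace X" using US by blast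
    fix C :: "'a set list set topology" and g
    assume C: "compact_space C" "Hausdorff_space C" and g: "continuous_map C X g"
    define K where "K = {c \<in> topspace C. g c \<in> S}"
    have K: "closedin C K"
      unfolding K_def by (rule closedin_continuous_map_preimage[OF g S])
    have topK: "topspace (subtopology C K) = K"
      using closedin_subset[OF K] by auto
    have "compact_space (subtopology C K)" "Hausdorff_space (subtopology C K)"
      using C K by (auto simp: closedin_compact_space compact_space_subtopology
          Hausdorff_space_subtopology)
    moreover have "continuous_map (subtopology C K) (subtopology X S) g"
      using g by (auto simp: continuous_map_in_subtopology continuous_map_from_subtopology K_def)
    ultimately have "openin (subtopology C K) {c \<in> K. g c \<in> U}"
      using openin_ch_kification_preimage[OF U] topK by metis
    then have "closedin (subtopology C K) (K - {c \<in> K. g c \<in> U})"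
      using topK by (metis openin_closedin_eq)
    then have "closedin C (K - {c \<in> K. g c \<in> U})"
      using K closedin_trans_full by blast
    moreover have "{c \<in> topspace C. g c \<in> U \<union> (topspace X - S)}
        = topspace C - (K - {c \<in> K. g c \<in> U})"
      using g US unfolding K_def by (auto simp: continuous_map_def)
    ultimately show "openin C {c \<in> topspace C. g c \<in> U \<union> (topspace X - S)}"
      by (simp add: openin_diff)
  qed
  moreover have "U = (U \<union> (topspace X - S)) \<inter> S" using US by blast
  ultimately show "openin (subtopology X S) U"
    unfolding openin_subtopology by blast
qed

text \<open>A tube argument: shrink the open slice over \<open>x\<close> to a closed neighbourhood
  \<open>K\<close> of \<open>c\<close>, then thicken \<open>x\<close> to the set of all
  \<open>z\<close> whose whole tube over \<open>K\<close> lies in \<open>U\<close>.\<close>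

lemma ch_k_space_prod_compact_Hausdorff:
  assumes X: "ch_k_space X" and C: "compact_space C" "Hausdorff_space C"
  shows "ch_k_space (prod_topology X C)"
  unfolding ch_k_space_iff
proof (intro allI impI)
  fix U assume U: "openin (ch_kification (prod_topology X C)) U"
  have sub: "U \<subseteq> topspace X \<times> topspace C" using openin_subset[OF U] by simp
  show "openin (prod_topology X C) U"
    unfolding openin_prod_topology_alt
  proof (intro allI impI)
    fix x c assume xc: "(x, c) \<in> U"
    then have x: "x \<in> topspace X" and c: "c \<in> topspace C" using sub by auto
    have "continuous_map C (prod_topology X C) (\<lambda>c. (x, c))"
      using x by (simp add: continuous_map_pairwise o_def)
    then have slice: "openin C {c \<in> topspace C. (x, c) \<in> U}"
      by (rule openin_ch_kification_preimage[OF U C])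
    have "regular_space C"
      using C by (simp add: compact_Hausdorff_imp_regular_space)
    then obtain W K where W: "openin C W" "closedin C K" "c \<in> W" "W \<subseteq> K"
        and K: "K \<subseteq> {c \<in> topspace C. (x, c) \<in> U}"
      using slice xc c unfolding neighbourhood_base_of_closedin[symmetric] neighbourhood_base_of
      by (metis (mono_tags, lifting) mem_Collect_eq)
    define V where "V = {z \<in> topspace X. \<forall>k\<in>K. (z, k) \<in> U}"
    have "openin X V"
    proof (rule ch_k_space_openinI[OF X])
      show "V \<subseteq> topspace X" unfolding V_def by blast
      fix T :: "'a set list set topology" and g
      assume T: "compact_space T" "Hausdorff_space T" and g: "continuous_map T X g"
      let ?P = "prod_topology T C"
      define M where "M = {p \<in> topspace ?P. (\<lambda>(t, k). (g t, k)) p \<in> U}"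
      \<comment> \<open>\<open>T\<close> x \<open>C\<close> is itself compact Hausdorff, so it can
        serve as a test space for \<open>U\<close>.\<close>
      have "continuous_map ?P (prod_topology X C) (\<lambda>(t, k). (g t, k))"
        using g by (simp add: continuous_map_prod_top)
      then have "openin ?P M"
        unfolding M_def using U T C
        by (intro openin_ch_kification_preimage)
          (auto simp: compact_space_prod_topology Hausdorff_space_prod_topology)
      moreover have "closedin ?P (topspace T \<times> K)"
        using W by (simp add: closedin_prod_Times_iff)
      \<comment> \<open>Projection along the compact \<open>C\<close> is closed; the image consists
        of the \<open>t\<close> for which some \<open>k\<close> in \<open>K\<close> has
        \<open>(g t, k)\<close> outside \<open>U\<close>.\<close>
      ultimately have "closedin T (fst ` (topspace T \<times> K - M))"
        using closed_map_fst[OF C(1)] unfolding closed_map_def by blast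
      moreover have "{t \<in> topspace T. g t \<in> V} = topspace T - fst ` (topspace T \<times> K - M)"
      proof -
        have "g t \<in> V \<longleftrightarrow> t \<notin> fst ` (topspace T \<times> K - M)" if t: "t \<in> topspace T" for t
        proof -
          have "g t \<in> topspace X" using g t by (auto simp: continuous_map_def)
          moreover have "(t, k) \<in> M \<longleftrightarrow> (g t, k) \<in> U" if "k \<in> K" for k
            using t that closedin_subset[OF W(2)] unfolding M_def by auto
          ultimately show ?thesis using t unfolding V_def by force
        qed
        then show ?thesis by blast
      qed
      ultimately show "openin T {t \<in> topspace T. g t \<in> V}"
        by (simp add: openin_diff)
    qed
    moreover have "x \<in> V" using x K unfolding V_def by blast
    moreover have "V \<times> W \<subseteq> U" using W(4) unfolding V_def by blast
    ultimately show "\<exists>V W. openin X V \<and> openin C W \<and> x \<in> V \<and> c \<in> W \<and> V \<times> W \<subseteq> U"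
      using W by blast
  qed
qed

text \<open>The graph is the preimage of the diagonal under id x \<open>h\<close>. The diagonal is
  closed only in the k-ified square, and this map is continuous into it because \<open>B\<close> x
  \<open>C\<close> is a k-space.\<close>

lemma closedin_graph_weak_Hausdorff:
  assumes B: "ch_k_space B" "weak_Hausdorff_space B"
    and C: "compact_space C" "Hausdorff_space C" and h: "continuous_map C B h"
  shows "closedin (prod_topology B C) {(b, c). c \<in> topspace C \<and> b = h c}"
proof -
  have "continuous_map (prod_topology B C) (prod_topology B B) (\<lambda>(b, c). (b, h c))"
    using h by (simp add: continuous_map_prod_top)
  then have "continuous_map (prod_topology B C) (ch_k_prod B B) (\<lambda>(b, c). (b, h c))"
    unfolding ch_k_prod_def
    by (intro continuous_map_ch_kification ch_k_space_prod_compact_Hausdorff B C)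
  then have "closedin (prod_topology B C)
      {p \<in> topspace (prod_topology B C). (\<lambda>(b, c). (b, h c)) p \<in> (\<lambda>b. (b, b)) ` topspace B}"
    using B(2) unfolding weak_Hausdorff_space_def by (rule closedin_continuous_map_preimage)
  moreover have "{p \<in> topspace (prod_topology B C).
        (\<lambda>(b, c). (b, h c)) p \<in> (\<lambda>b. (b, b)) ` topspace B}
      = {(b, c). c \<in> topspace C \<and> b = h c}"
    using h by (auto simp: continuous_map_def)
  ultimately show ?thesis by simp
qed

text \<open>The theorem over a compact Hausdorff base, where the ordinary subspace topology on the
  pullback is already that of a k-space.\<close>

lemma pullback_compact_Hausdorff:
  fixes C :: "'c topology"
  assumes B: "ch_k_space B" "weak_Hausdorff_space B" and Y: "ch_k_space Y"
    and q: "quotient_map Y B q"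
    and C: "compact_space C" "Hausdorff_space C" and h: "continuous_map C B h"
  defines "P \<equiv> subtopology (prod_topology Y C)
      {(y, c). y \<in> topspace Y \<and> c \<in> topspace C \<and> q y = h c}"
  shows "ch_k_space P" and "quotient_map P C snd"
proof -
  let ?G = "{(b, c). c \<in> topspace C \<and> b = h c}"
  let ?S = "{(y, c). y \<in> topspace Y \<and> c \<in> topspace C \<and> q y = h c}"
  let ?qC = "\<lambda>(y, c :: 'c). (q y, c)"
  have G: "closedin (prod_topology B C) ?G"
    by (rule closedin_graph_weak_Hausdorff[OF B C h])
  \<comment> \<open>Whitehead's theorem: the product of a quotient map with the identity of a
    locally compact Hausdorff space is a quotient map.\<close>
  have qC: "quotient_map (prod_topology Y C) (prod_topology B C) ?qC"
    using C q by (intro quotient_map_prod_left) (auto simp: compact_imp_locally_compact_space)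
  have S: "{p \<in> topspace (prod_topology Y C). ?qC p \<in> ?G} = ?S"
    by auto
  have "closedin (prod_topology Y C) ?S"
    using closedin_continuous_map_preimage[OF quotient_imp_continuous_map[OF qC] G]
    unfolding S .
  then show "ch_k_space P"
    unfolding P_def
    by (intro ch_k_space_closed_subtopology ch_k_space_prod_compact_Hausdorff Y C)
  \<comment> \<open>A quotient map restricts to a quotient map over a closed subset of its
    target.\<close>
  have "quotient_map P (subtopology (prod_topology B C) ?G) ?qC"
    unfolding P_def using quotient_map_restriction[OF qC S] G by blast
  \<comment> \<open>The map \<open>c\<close> to \<open>(h c, c)\<close> is a continuous section of
    \<open>snd\<close>, and a continuous map with a continuous section is a quotient map.\<close>
  moreover have "quotient_map (subtopology (prod_topology B C) ?G) C snd"
  proof (rule quotient_map_from_composition)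
    show "continuous_map C (subtopology (prod_topology B C) ?G) (\<lambda>c. (h c, c))"
      using h by (auto simp: continuous_map_in_subtopology continuous_map_pairwise o_def)
    show "continuous_map (subtopology (prod_topology B C) ?G) C snd"
      by (simp add: continuous_map_from_subtopology continuous_map_snd)
    show "quotient_map C C (snd \<circ> (\<lambda>c. (h c, c)))"
      by (auto simp: quotient_map_def o_def Int_absorb1 simp flip: Int_def dest: openin_subset)
  qed
  ultimately have "quotient_map P C (snd \<circ> ?qC)"
    by (rule quotient_map_compose)
  moreover have "snd \<circ> ?qC = snd" by auto
  ultimately show "quotient_map P C snd" by (simp only:)
qed

theorem theorem14:
  fixes A :: "'a topology" and B :: "'b topology" and Y :: "'y topology"
    and q :: "'y \<Rightarrow> 'b" and f :: "'a \<Rightarrow> 'b"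
  assumes "ch_k_space A" and "ch_k_space B" and "ch_k_space Y"
    and "weak_Hausdorff_space B"
    and "quotient_map Y B q"
    and "continuous_map A B f"
  shows "quotient_map (ch_k_pullback Y A q f) A snd"
proof -
  let ?S = "{(y, a). y \<in> topspace Y \<and> a \<in> topspace A \<and> q y = f a}"
  let ?P = "ch_k_pullback Y A q f"
  have topP: "topspace ?P = ?S"
    unfolding ch_k_pullback_def by auto
  have surj: "snd ` ?S = topspace A"
  proof
    show "topspace A \<subseteq> snd ` ?S"
    proof
      fix a assume a: "a \<in> topspace A"
      then have "f a \<in> q ` topspace Y"
        using assms(5,6) by (auto simp: quotient_map_def continuous_map_def)
      then show "a \<in> snd ` ?S" using a by force
    qed
  qed auto
  show ?thesis
    unfolding quotient_map_def topP
  proof (intro conjI allI impI surj iffI)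
    fix W assume "openin A W"
    then have "openin (subtopology (prod_topology Y A) ?S)
        {p \<in> topspace (subtopology (prod_topology Y A) ?S). snd p \<in> W}"
      by (intro openin_continuous_map_preimage[of _ A] continuous_map_from_subtopology
          continuous_map_snd)
    then have "openin ?P {p \<in> topspace ?P. snd p \<in> W}"
      unfolding ch_k_pullback_def topspace_ch_kification
      by (rule openin_imp_openin_ch_kification)
    then show "openin ?P {p \<in> ?S. snd p \<in> W}"
      unfolding topP .
  next
    fix W assume W: "W \<subseteq> topspace A" and open_pre: "openin ?P {p \<in> ?S. snd p \<in> W}"
    show "openin A W"
    proof (rule ch_k_space_openinI[OF assms(1) W])
      fix C :: "'a set list set topology" and g
      assume C: "compact_space C" "Hausdorff_space C" and g: "continuous_map C A g"
      \<comment> \<open>The pullback of \<open>q\<close> along \<open>f\<close> after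
        \<open>g\<close>, to which the compact Hausdorff case applies.\<close>
      define R where "R = subtopology (prod_topology Y C)
          {(y, c). y \<in> topspace Y \<and> c \<in> topspace C \<and> q y = (f \<circ> g) c}"
      have R: "ch_k_space R" "quotient_map R C snd"
        using pullback_compact_Hausdorff[OF assms(2,4,3,5) C continuous_map_compose[OF g assms(6)]]
        unfolding R_def by blast+
      have gA: "g c \<in> topspace A" if "c \<in> topspace C" for c
        using g that by (auto simp: continuous_map_def)
      have topR: "topspace R = {(y, c). y \<in> topspace Y \<and> c \<in> topspace C \<and> q y = f (g c)}"
        unfolding R_def by auto
      have "continuous_map R (prod_topology Y A) (\<lambda>(y, c). (y, g c))"
        unfolding R_def using g
        by (intro continuous_map_from_subtopology) (simp add: continuous_map_prod_top)
      then have "continuous_map R (subtopology (prod_topology Y A) ?S) (\<lambda>(y, c). (y, g c))"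
        using gA by (auto simp: continuous_map_in_subtopology topR)
      \<comment> \<open>Since \<open>R\<close> is a k-space, the comparison map stays continuous
        when its target is k-ified.\<close>
      then have "continuous_map R ?P (\<lambda>(y, c). (y, g c))"
        unfolding ch_k_pullback_def by (rule continuous_map_ch_kification[OF R(1)])
      then have "openin R {r \<in> topspace R. (\<lambda>(y, c). (y, g c)) r \<in> {p \<in> ?S. snd p \<in> W}}"
        using open_pre by (rule openin_continuous_map_preimage)
      \<comment> \<open>The comparison map followed by \<open>snd\<close> is \<open>g\<close> after
        \<open>snd\<close>, so the set is the \<open>snd\<close>-preimage of the preimage of
        \<open>W\<close> under \<open>g\<close>, and the quotient map from \<open>R\<close> to
        \<open>C\<close> detects whether the latter is open.\<close>
      moreover have "{r \<in> topspace R. (\<lambda>(y, c). (y, g c)) r \<in> {p \<in> ?S. snd p \<in> W}}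
          = {r \<in> topspace R. snd r \<in> {c \<in> topspace C. g c \<in> W}}"
        using gA by (auto simp: topR)
      ultimately have "openin R {r \<in> topspace R. snd r \<in> {c \<in> topspace C. g c \<in> W}}"
        by (simp only:)
      moreover have "{c \<in> topspace C. g c \<in> W} \<subseteq> topspace C"
        by blast
      ultimately show "openin C {c \<in> topspace C. g c \<in> W}"
        using R(2) unfolding quotient_map_def by blast
    qed
  qed
qed

end
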